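(* Let $X$ be a compact topological space, $f_{1,\infty}=\{f_i\}_{i=1}^\infty$ a sequence of continuous self-maps of $X$, and $Z\subseteq X$. Then for any $1\le i<j<\infty$ and $\theta\in[0,1]$, the following hold. (1) If $Z$ is $f_{1,\infty}$-forward invariant (i.e. $f_k(Z)\subseteq Z$ for all $k\in\mathbb N$), then \[ \underline{h}_{\mathrm{top}}(f_{i,\infty},Z,\theta)\le\underline{h}_{\mathrm{top}}(f_{j,\infty},Z,\theta),\qquad \overline{h}_{\mathrm{top}}(f_{i,\infty},Z,\theta)\le\overline{h}_{\mathrm{top}}(f_{j,\infty},Z,\theta). \] (2) If $Z$ is $f_{1,\infty}$-backward invariant (i.e. $Z\subseteq f_k(Z)$ for all $k\in\mathbb N$), then \[ \underline{h}_{\mathrm{top}}(f_{i,\infty},Z,\theta)\ge\underline{h}_{\mathrm{top}}(f_{j,\infty},Z,\theta),\qquad \overline{h}_{\mathrm{top}}(f_{i,\infty},Z,\theta)\ge\overline{h}_{\mathrm{top}}(f_{j,\infty},Z,\theta). \] (3) If $Z$ is $f_{1,\infty}$-invariant (i.e. $f_k(Z)=Z$ for all $k\in\mathbb N$), then \[ \underline{h}_{\mathrm{top}}(f_{i,\infty},Z,\theta)=\underline{h}_{\mathrm{top}}(f_{j,\infty},Z,\theta),\qquad \overline{h}_{\mathrm{top}}(f_{i,\infty},Z,\theta)=\overline{h}_{\mathrm{top}}(f_{j,\infty},Z,\theta). \]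
   Context: Intermediate topological entropies. Let $X$ be a compact topological space and $f_{1,\infty}=\{f_i\}_{i=1}^\infty$ a sequence of continuous maps $X\to X$. Put $f_i^0=\mathrm{id}_X$ and $f_i^j=f_{i+j-1}\circ\cdots\circ f_{i+1}\circ f_i$ for $j\ge1$. For a finite open cover $\mathcal U$ of $X$ and $m\in\mathbb N=\{1,2,\dots\}$, a string of length $m(\mathbf U)=m$ is an element $\mathbf U=(U_0,\dots,U_{m-1})\in\mathcal S_m(\mathcal U):=\mathcal U^m$, and $X(\mathbf U)=\{x\in X: f_1^j(x)\in U_j,\ 0\le j\le m-1\}$. For $Z\subseteq X$, $\alpha\ge0$, $\theta\in[0,1]$, $N\in\mathbb N$ let \[ M(Z,\alpha,\mathcal U,N,\theta)=\inf_{\mathcal G}\sum_{\mathbf U\in\mathcal G}e^{-\alpha m(\mathbf U)}, \] the infimum over all finite or countable collections $\mathcal G\subseteq\bigcup_{N\le m<N/\theta+1}\mathcal S_m(\mathcal U)$ with $Z\subseteq\bigcup_{\mathbf U\in\mathcal G}X(\mathbf U)$ (for $\theta=0$, $N/\theta=+\infty$). Let $\underline m(Z,\alpha,\mathcal U,\theta)=\liminf_{N\to\infty}M(Z,\alpha,\mathcal U,N,\theta)$ and $\overline m(Z,\alpha,\mathcal U,\theta)=\limsup_{N\to\infty}M(Z,\alpha,\mathcal U,N,\theta)$. Set $\underline h_{\mathrm{top}}(f_{1,\infty},Z,\mathcal U,\theta)=\inf\{\alpha\ge0:\underline m(Z,\alpha,\mathcal U,\theta)=0\}$, $\overline h_{\mathrm{top}}(f_{1,\infty},Z,\mathcal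 U,\theta)=\inf\{\alpha\ge0:\overline m(Z,\alpha,\mathcal U,\theta)=0\}$. The lower and upper $\theta$-intermediate topological entropies $\underline h_{\mathrm{top}}(f_{1,\infty},Z,\theta)$ and $\overline h_{\mathrm{top}}(f_{1,\infty},Z,\theta)$, with values in $[0,\infty]$, are the suprema of these quantities over all finite open covers $\mathcal U$ of $X$. For $k\in\mathbb N$, $f_{k,\infty}=\{f_k,f_{k+1},\dots\}$ denotes the shifted sequence, and its entropies are defined in the same way (with $f_k^j$ in place of $f_1^j$). *)

theory Defs
  imports "HOL-Analysis.Analysis"
begin

text \<open>
  A sequence of self-maps \<open>f\<^sub>1, f\<^sub>2, \<dots>\<close> is a function on \<open>nat\<close> whose value at \<open>0\<close> is never used.
  The shifted sequence \<open>f\<^sub>k, f\<^sub>k\<^sub>+\<^sub>1, \<dots>\<close> is represented by the pair of \<open>f\<close> and its starting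
  index \<open>k\<close>; thus all notions below carry a parameter \<open>k\<close>, and \<open>k = 1\<close> is the original sequence.
\<close>

text \<open>\<open>seq_comp f k j\<close> is \<open>f\<^sub>k\<^sub>+\<^sub>j\<^sub>-\<^sub>1 \<circ> \<dots> \<circ> f\<^sub>k\<^sub>+\<^sub>1 \<circ> f\<^sub>k\<close> (with \<open>j\<close> factors).\<close>

primrec seq_comp :: "(nat \<Rightarrow> 'a \<Rightarrow> 'a) \<Rightarrow> nat \<Rightarrow> nat \<Rightarrow> 'a \<Rightarrow> 'a" where
  "seq_comp f k 0 = id"
| "seq_comp f k (Suc j) = f (k + j) \<circ> seq_comp f k j"

definition finite_open_cover :: "'a topology \<Rightarrow> 'a set set \<Rightarrow> bool" where
  "finite_open_cover X \<U> \<longleftrightarrow> finite \<U> \<and> (\<forall>U\<in>\<U>. openin X U) \<and> \<Union>\<U> = topspace X"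

text \<open>
  Strings over a cover are lists of its members. The case distinction on \<open>\<theta> = 0\<close> encodes
  \<open>N / 0 = \<infinity>\<close>, since division by zero yields \<open>0\<close> in type \<open>real\<close>.
\<close>

definition cover_strings :: "'a set set \<Rightarrow> nat \<Rightarrow> real \<Rightarrow> 'a set list set" where
  "cover_strings \<U> N \<theta> =
     {Us \<in> lists \<U>. N \<le> length Us \<and> (\<theta> = 0 \<or> real (length Us) < real N / \<theta> + 1)}"

definition string_set ::
  "'a topology \<Rightarrow> (nat \<Rightarrow> 'a \<Rightarrow> 'a) \<Rightarrow> nat \<Rightarrow> 'a set list \<Rightarrow> 'a set" where
  "string_set X f k Us = {x \<in> topspace X. \<forall>j<length Us. seq_comp f k j x \<in> Us ! j}"

definition entropy_M ::
  "'a topology \<Rightarrow> (nat \<Rightarrow> 'a \<Rightarrow> 'a) \<Rightarrow> nat \<Rightarrow> 'a set \<Rightarrow> real \<Rightarrow> 'a set set \<Rightarrow> nat \<Rightarrow> real \<Rightarrow> ennreal"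
where
  "entropy_M X f k Z \<alpha> \<U> N \<theta> =
     (INF \<G> \<in> {\<G>. countable \<G> \<and> \<G> \<subseteq> cover_strings \<U> N \<theta>
                    \<and> Z \<subseteq> (\<Union>Us\<in>\<G>. string_set X f k Us)}.
        \<Sum>\<^sub>\<infinity>Us\<in>\<G>. ennreal (exp (- \<alpha> * real (length Us))))"

definition lower_m ::
  "'a topology \<Rightarrow> (nat \<Rightarrow> 'a \<Rightarrow> 'a) \<Rightarrow> nat \<Rightarrow> 'a set \<Rightarrow> real \<Rightarrow> 'a set set \<Rightarrow> real \<Rightarrow> ennreal" where
  "lower_m X f k Z \<alpha> \<U> \<theta> = liminf (\<lambda>N. entropy_M X f k Z \<alpha> \<U> N \<theta>)"

definition upper_m ::
  "'a topology \<Rightarrow> (nat \<Rightarrow> 'a \<Rightarrow> 'a) \<Rightarrow> nat \<Rightarrow> 'a set \<Rightarrow> real \<Rightarrow> 'a set set \<Rightarrow> real \<Rightarrow> ennreal" where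
  "upper_m X f k Z \<alpha> \<U> \<theta> = limsup (\<lambda>N. entropy_M X f k Z \<alpha> \<U> N \<theta>)"

text \<open>The infima are taken in \<open>ennreal\<close>, so that the infimum of the empty set is \<open>\<infinity>\<close>.\<close>

definition lower_entropy_cover ::
  "'a topology \<Rightarrow> (nat \<Rightarrow> 'a \<Rightarrow> 'a) \<Rightarrow> nat \<Rightarrow> 'a set \<Rightarrow> 'a set set \<Rightarrow> real \<Rightarrow> ennreal" where
  "lower_entropy_cover X f k Z \<U> \<theta> = (INF \<alpha> \<in> {\<alpha>. 0 \<le> \<alpha> \<and> lower_m X f k Z \<alpha> \<U> \<theta> = 0}. ennreal \<alpha>)"

definition upper_entropy_cover ::
  "'a topology \<Rightarrow> (nat \<Rightarrow> 'a \<Rightarrow> 'a) \<Rightarrow> nat \<Rightarrow> 'a set \<Rightarrow> 'a set set \<Rightarrow> real \<Rightarrow> ennreal" where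
  "upper_entropy_cover X f k Z \<U> \<theta> = (INF \<alpha> \<in> {\<alpha>. 0 \<le> \<alpha> \<and> upper_m X f k Z \<alpha> \<U> \<theta> = 0}. ennreal \<alpha>)"

definition lower_entropy ::
  "'a topology \<Rightarrow> (nat \<Rightarrow> 'a \<Rightarrow> 'a) \<Rightarrow> nat \<Rightarrow> 'a set \<Rightarrow> real \<Rightarrow> ennreal" where
  "lower_entropy X f k Z \<theta> = (SUP \<U> \<in> {\<U>. finite_open_cover X \<U>}. lower_entropy_cover X f k Z \<U> \<theta>)"

definition upper_entropy ::
  "'a topology \<Rightarrow> (nat \<Rightarrow> 'a \<Rightarrow> 'a) \<Rightarrow> nat \<Rightarrow> 'a set \<Rightarrow> real \<Rightarrow> ennreal" where
  "upper_entropy X f k Z \<theta> = (SUP \<U> \<in> {\<U>. finite_open_cover X \<U>}. upper_entropy_cover X f k Z \<U> \<theta>)"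

end

theory Submission
  imports Defs
begin

text \<open>
  It suffices to compare the entropies of \<open>f\<^sub>k\<^sub>,\<^sub>\<infinity>\<close> and \<open>f\<^sub>k\<^sub>+\<^sub>1\<^sub>,\<^sub>\<infinity>\<close>. If \<open>f\<^sub>k(Z) \<subseteq> W\<close>, prefixing the strings of a
  collection covering \<open>W\<close> with every member of \<open>\<U>\<close> yields a collection covering \<open>Z\<close>; its sum is larger
  by at most a factor \<open>card \<U>\<close>. If \<open>W \<subseteq> f\<^sub>k(Z)\<close>, deleting the first letters in a collection covering \<open>Z\<close>
  yields one covering \<open>W\<close>, but lengths that are admissible for \<open>N + 1\<close> can become too large for \<open>N\<close>.
  Truncating these strings to length \<open>\<lceil>N/\<theta>\<rceil>\<close> removes at most \<open>1/\<theta> + 1\<close> letters in all, which costs a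
  factor \<open>exp (\<alpha> (1/\<theta> + 1))\<close>. Neither factor depends on \<open>N\<close>, so the vanishing of the lower and upper
  limits carries over.
\<close>

section \<open>Strings under a shift of the starting index\<close>

text \<open>The recursion of \<open>seq_comp\<close> adds maps on the outside. Strings are
  lengthened and cut at the front, so the innermost map has to be split off instead.\<close>

lemma seq_comp_Suc_shift: "seq_comp f k (Suc j) x = seq_comp f (Suc k) j (f k x)"
  by (induction j) simp_all

lemma string_set_Cons:
  assumes "f k \<in> topspace X \<rightarrow> topspace X"
  shows "x \<in> string_set X f k (U # Us) \<longleftrightarrow>
    x \<in> topspace X \<and> x \<in> U \<and> f k x \<in> string_set X f (Suc k) Us"
  using assms
  by (auto simp: string_set_def seq_comp_Suc_shift All_less_Suc2 simp del: seq_comp.simps(2))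

lemma string_set_take: "string_set X f k Us \<subseteq> string_set X f k (take n Us)"
  by (auto simp: string_set_def)

section \<open>Infinite sums and infima in \<open>ennreal\<close>\<close>

lemma infsum_cmult_left_ennreal: "(\<Sum>\<^sub>\<infinity>x\<in>A. c * g x) = c * (\<Sum>\<^sub>\<infinity>x\<in>A. g x :: ennreal)"
  by (simp add: nonneg_infsum_complete SUP_mult_left_ennreal sum_distrib_left)

text \<open>The right-hand side counts each value once per preimage. Choosing one preimage for each
  value, which gives the set \<open>B\<close>, turns the left-hand side into a partial sum of the
  right-hand side.\<close>

lemma infsum_image_le_ennreal:
  fixes w :: "'b \<Rightarrow> ennreal"
  shows "infsum w (g ` A) \<le> (\<Sum>\<^sub>\<infinity>x\<in>A. w (g x))"
proof -
  obtain B where B: "B \<subseteq> A" "inj_on g B" "g ` A = g ` B"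
    by (metis subset_image_inj order_refl)
  have "infsum w (g ` A) = (\<Sum>\<^sub>\<infinity>x\<in>B. w (g x))"
    using B by (simp add: infsum_reindex o_def)
  also have "\<dots> \<le> (\<Sum>\<^sub>\<infinity>x\<in>A. w (g x))"
    using B by (intro infsum_mono_neutral nonneg_summable_on_complete) auto
  finally show ?thesis .
qed

text \<open>A positive finite factor can be moved to the other side by division. Positivity also
  covers empty \<open>A\<close>, where the infimum is infinite.\<close>

lemma le_cmult_INF_ennreal:
  fixes a :: ennreal and c :: real
  assumes "0 < c" and "\<And>x. x \<in> A \<Longrightarrow> a \<le> ennreal c * g x"
  shows "a \<le> ennreal c * (INF x\<in>A. g x)"
proof -
  have iff: "a \<le> ennreal c * y \<longleftrightarrow> a / ennreal c \<le> y" for y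
    using assms(1) ennreal_mult_le_mult_iff[of "ennreal c" "a / ennreal c" y]
    by (simp add: ennreal_times_divide mult_divide_eq_ennreal mult.commute[of _ a])
  show ?thesis
    using assms(2) by (simp add: iff le_INF_iff)
qed

section \<open>From coverings to entropies\<close>

text \<open>Reduces a comparison of two infima to a transformation of coverings. If \<open>Z\<close>
  has no admissible covering, the right-hand side is infinite because \<open>c\<close> is
  positive.\<close>

lemma entropy_M_cmult_le:
  assumes "0 < c"
    and "\<And>\<G>. countable \<G> \<Longrightarrow> \<G> \<subseteq> cover_strings \<U> N \<theta> \<Longrightarrow> Z \<subseteq> (\<Union>Us\<in>\<G>. string_set X f k Us) \<Longrightarrow>
      \<exists>\<H>. countable \<H> \<and> \<H> \<subseteq> cover_strings \<U> N' \<theta> \<and> W \<subseteq> (\<Union>Us\<in>\<H>. string_set X f l Us) \<and>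
        (\<Sum>\<^sub>\<infinity>Us\<in>\<H>. ennreal (exp (- \<alpha> * real (length Us))))
          \<le> ennreal c * (\<Sum>\<^sub>\<infinity>Us\<in>\<G>. ennreal (exp (- \<alpha> * real (length Us))))"
  shows "entropy_M X f l W \<alpha> \<U> N' \<theta> \<le> ennreal c * entropy_M X f k Z \<alpha> \<U> N \<theta>"
  unfolding entropy_M_def[of X f k]
proof (rule le_cmult_INF_ennreal[OF assms(1)])
  fix \<G> assume "\<G> \<in> {\<G>. countable \<G> \<and> \<G> \<subseteq> cover_strings \<U> N \<theta>
                    \<and> Z \<subseteq> (\<Union>Us\<in>\<G>. string_set X f k Us)}"
  with assms(2) obtain \<H> where \<H>: "countable \<H>" "\<H> \<subseteq> cover_strings \<U> N' \<theta>"
      "W \<subseteq> (\<Union>Us\<in>\<H>. string_set X f l Us)"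
    and le: "(\<Sum>\<^sub>\<infinity>Us\<in>\<H>. ennreal (exp (- \<alpha> * real (length Us))))
          \<le> ennreal c * (\<Sum>\<^sub>\<infinity>Us\<in>\<G>. ennreal (exp (- \<alpha> * real (length Us))))"
    by (smt (verit) mem_Collect_eq)
  show "entropy_M X f l W \<alpha> \<U> N' \<theta>
      \<le> ennreal c * (\<Sum>\<^sub>\<infinity>Us\<in>\<G>. ennreal (exp (- \<alpha> * real (length Us))))"
    unfolding entropy_M_def using \<H> by (intro order_trans[OF _ le] INF_lower) auto
qed

lemma entropy_cover_mono:
  assumes "\<And>\<alpha>. 0 \<le> \<alpha> \<Longrightarrow> \<exists>c. \<forall>N.
      entropy_M X f k Z \<alpha> \<U> (N + a) \<theta> \<le> ennreal c * entropy_M X f l W \<alpha> \<U> (N + b) \<theta>"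
  shows lower_entropy_cover_mono: "lower_entropy_cover X f k Z \<U> \<theta> \<le> lower_entropy_cover X f l W \<U> \<theta>"
    and upper_entropy_cover_mono: "upper_entropy_cover X f k Z \<U> \<theta> \<le> upper_entropy_cover X f l W \<U> \<theta>"
proof -
  have "lower_m X f k Z \<alpha> \<U> \<theta> = 0" if \<alpha>: "0 \<le> \<alpha>" "lower_m X f l W \<alpha> \<U> \<theta> = 0" for \<alpha>
  proof -
    obtain c where c: "\<And>N. entropy_M X f k Z \<alpha> \<U> (N + a) \<theta> \<le> ennreal c * entropy_M X f l W \<alpha> \<U> (N + b) \<theta>"
      using assms \<alpha>(1) by blast
    have "lower_m X f k Z \<alpha> \<U> \<theta> = liminf (\<lambda>N. entropy_M X f k Z \<alpha> \<U> (N + a) \<theta>)"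
      unfolding lower_m_def by (rule liminf_shift_k[symmetric])
    also have "\<dots> \<le> liminf (\<lambda>N. ennreal c * entropy_M X f l W \<alpha> \<U> (N + b) \<theta>)"
      using c by (intro Liminf_mono always_eventually allI)
    \<comment> \<open>Multiplication by a finite constant is continuous and monotone, so it commutes
      with the lower limit.\<close>
    also have "\<dots> = ennreal c * liminf (\<lambda>N. entropy_M X f l W \<alpha> \<U> (N + b) \<theta>)"
      by (intro Liminf_compose_continuous_mono[where f = "\<lambda>x. ennreal c * x"] ennreal_continuous_on_cmult continuous_on_id)
        (auto intro!: monoI mult_left_mono)
    also have "\<dots> = 0"
      using \<alpha>(2) liminf_shift_k[of "\<lambda>N. entropy_M X f l W \<alpha> \<U> N \<theta>" b] by (simp add: lower_m_def)
    finally show ?thesis by simp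
  qed
  then show "lower_entropy_cover X f k Z \<U> \<theta> \<le> lower_entropy_cover X f l W \<U> \<theta>"
    unfolding lower_entropy_cover_def by (intro INF_superset_mono) auto
  have "upper_m X f k Z \<alpha> \<U> \<theta> = 0" if \<alpha>: "0 \<le> \<alpha>" "upper_m X f l W \<alpha> \<U> \<theta> = 0" for \<alpha>
  proof -
    obtain c where c: "\<And>N. entropy_M X f k Z \<alpha> \<U> (N + a) \<theta> \<le> ennreal c * entropy_M X f l W \<alpha> \<U> (N + b) \<theta>"
      using assms \<alpha>(1) by blast
    have "upper_m X f k Z \<alpha> \<U> \<theta> = limsup (\<lambda>N. entropy_M X f k Z \<alpha> \<U> (N + a) \<theta>)"
      unfolding upper_m_def by (rule limsup_shift_k[symmetric])
    also have "\<dots> \<le> limsup (\<lambda>N. ennreal c * entropy_M X f l W \<alpha> \<U> (N + b) \<theta>)"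
      using c by (intro Limsup_mono always_eventually allI)
    also have "\<dots> = ennreal c * limsup (\<lambda>N. entropy_M X f l W \<alpha> \<U> (N + b) \<theta>)"
      by (intro Limsup_compose_continuous_mono[where f = "\<lambda>x. ennreal c * x"] ennreal_continuous_on_cmult continuous_on_id)
        (auto intro!: monoI mult_left_mono)
    also have "\<dots> = 0"
      using \<alpha>(2) limsup_shift_k[of "\<lambda>N. entropy_M X f l W \<alpha> \<U> N \<theta>" b] by (simp add: upper_m_def)
    finally show ?thesis by simp
  qed
  then show "upper_entropy_cover X f k Z \<U> \<theta> \<le> upper_entropy_cover X f l W \<U> \<theta>"
    unfolding upper_entropy_cover_def by (intro INF_superset_mono) auto
qed

lemma entropy_mono:
  assumes "\<And>\<U> \<alpha>. finite_open_cover X \<U> \<Longrightarrow> 0 \<le> \<alpha> \<Longrightarrow> \<exists>c. \<forall>N.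
      entropy_M X f k Z \<alpha> \<U> (N + a) \<theta> \<le> ennreal c * entropy_M X f l W \<alpha> \<U> (N + b) \<theta>"
  shows lower_entropy_mono: "lower_entropy X f k Z \<theta> \<le> lower_entropy X f l W \<theta>"
    and upper_entropy_mono: "upper_entropy X f k Z \<theta> \<le> upper_entropy X f l W \<theta>"
  unfolding lower_entropy_def upper_entropy_def
proof -
  show "(SUP \<U>\<in>{\<U>. finite_open_cover X \<U>}. lower_entropy_cover X f k Z \<U> \<theta>)
      \<le> (SUP \<U>\<in>{\<U>. finite_open_cover X \<U>}. lower_entropy_cover X f l W \<U> \<theta>)"
    using assms by (intro SUP_subset_mono lower_entropy_cover_mono) auto
  show "(SUP \<U>\<in>{\<U>. finite_open_cover X \<U>}. upper_entropy_cover X f k Z \<U> \<theta>)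
      \<le> (SUP \<U>\<in>{\<U>. finite_open_cover X \<U>}. upper_entropy_cover X f l W \<U> \<theta>)"
    using assms by (intro SUP_subset_mono upper_entropy_cover_mono) auto
qed

section \<open>Prefixing letters: from index \<open>Suc k\<close> to index \<open>k\<close>\<close>

text \<open>Since 1/\<theta> is at least 1 for positive \<theta>, raising \<open>N\<close> by one
  raises the upper bound on the length by at least the one letter added.\<close>

lemma cover_strings_Cons:
  assumes "0 \<le> \<theta>" "\<theta> \<le> 1" "U \<in> \<U>" "Us \<in> cover_strings \<U> N \<theta>"
  shows "U # Us \<in> cover_strings \<U> (Suc N) \<theta>"
proof -
  have "real (length (U # Us)) < real (Suc N) / \<theta> + 1" if "\<theta> \<noteq> 0"
  proof -
    have "real (length Us) < real N / \<theta> + 1" "1 \<le> 1 / \<theta>"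
      using assms that by (auto simp: cover_strings_def)
    then show ?thesis by (simp add: add_divide_distrib)
  qed
  with assms show ?thesis by (auto simp: cover_strings_def)
qed

text \<open>The summand 1 in the factor keeps it positive even for the empty cover, which occurs
  when the space is empty.\<close>

lemma entropy_M_Suc_le:
  assumes "f k \<in> topspace X \<rightarrow> topspace X" "Z \<subseteq> topspace X" "f k ` Z \<subseteq> W"
    and "0 \<le> \<theta>" "\<theta> \<le> 1" "finite \<U>" "\<Union>\<U> = topspace X" "0 \<le> \<alpha>"
  shows "entropy_M X f k Z \<alpha> \<U> (Suc N) \<theta>
    \<le> ennreal (1 + card \<U>) * entropy_M X f (Suc k) W \<alpha> \<U> N \<theta>"
proof (rule entropy_M_cmult_le)
  fix \<G> assume \<G>: "countable \<G>" "\<G> \<subseteq> cover_strings \<U> N \<theta>" "W \<subseteq> (\<Union>Us\<in>\<G>. string_set X f (Suc k) Us)"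
  let ?w = "\<lambda>Us :: 'a set list. ennreal (exp (- \<alpha> * real (length Us)))"
  let ?\<H> = "\<Union>U\<in>\<U>. Cons U ` \<G>"
  have "Z \<subseteq> (\<Union>Us\<in>?\<H>. string_set X f k Us)"
  proof
    fix x assume x: "x \<in> Z"
    then obtain U where "U \<in> \<U>" "x \<in> U"
      using assms by blast
    moreover obtain Us where "Us \<in> \<G>" "f k x \<in> string_set X f (Suc k) Us"
      using x assms(3) \<G>(3) by blast
    moreover have "x \<in> topspace X" using x assms(2) by blast
    ultimately have "U # Us \<in> ?\<H>" "x \<in> string_set X f k (U # Us)"
      by (auto simp: string_set_Cons[where f = f, OF assms(1)])
    then show "x \<in> (\<Union>Us\<in>?\<H>. string_set X f k Us)" by blast
  qed
  moreover have "infsum ?w ?\<H> \<le> ennreal (1 + card \<U>) * infsum ?w \<G>"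
  proof -
    \<comment> \<open>The union is disjoint, because strings from different \<open>U\<close> differ
      in their first letter.\<close>
    have "infsum ?w ?\<H> = (\<Sum>U\<in>\<U>. infsum ?w (Cons U ` \<G>))"
      using assms(6) by (intro sum_infsum[symmetric] nonneg_summable_on_complete) auto
    also have "\<dots> \<le> (\<Sum>U\<in>\<U>. infsum ?w \<G>)"
    proof (rule sum_mono)
      fix U
      have "infsum ?w (Cons U ` \<G>) \<le> (\<Sum>\<^sub>\<infinity>Us\<in>\<G>. ?w (U # Us))"
        by (rule infsum_image_le_ennreal)
      \<comment> \<open>A longer string has no larger weight, as \<alpha> is nonnegative.\<close>
      also have "\<dots> \<le> infsum ?w \<G>"
        using assms(8) by (intro infsum_mono nonneg_summable_on_complete) (auto intro!: ennreal_leI mult_left_mono)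
      finally show "infsum ?w (Cons U ` \<G>) \<le> infsum ?w \<G>" .
    qed
    also have "\<dots> = ennreal (card \<U>) * infsum ?w \<G>"
      by (simp add: ennreal_of_nat_eq_real_of_nat)
    also have "\<dots> \<le> ennreal (1 + card \<U>) * infsum ?w \<G>"
      by (intro mult_right_mono ennreal_leI) auto
    finally show ?thesis .
  qed
  moreover have "countable ?\<H>" "?\<H> \<subseteq> cover_strings \<U> (Suc N) \<theta>"
    using \<G> assms by (auto intro: countable_finite cover_strings_Cons)
  ultimately show "\<exists>\<H>. countable \<H> \<and> \<H> \<subseteq> cover_strings \<U> (Suc N) \<theta> \<and>
      Z \<subseteq> (\<Union>Us\<in>\<H>. string_set X f k Us) \<and> infsum ?w \<H> \<le> ennreal (1 + card \<U>) * infsum ?w \<G>"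
    by blast
qed simp

section \<open>Deleting letters: from index \<open>k\<close> to index \<open>Suc k\<close>\<close>

text \<open>For \<open>\<theta> = 0\<close> there is no upper bound on the length, and since \<open>1 / 0 = 0\<close> the loss is one letter.\<close>

lemma in_set_tl: "x \<in> set (tl xs) \<Longrightarrow> x \<in> set xs"
  by (cases xs) simp_all

lemma cover_strings_shorten:
  assumes "0 \<le> \<theta>" "\<theta> \<le> 1"
  obtains g where "\<And>Us. \<exists>n. g Us = take n (tl Us)"
    and "\<And>Us. Us \<in> cover_strings \<U> (Suc N) \<theta> \<Longrightarrow> g Us \<in> cover_strings \<U> N \<theta>"
    and "\<And>Us. Us \<in> cover_strings \<U> (Suc N) \<theta> \<Longrightarrow>
      real (length Us) \<le> real (length (g Us)) + (1 + 1 / \<theta>)"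
proof (cases "\<theta> = 0")
  case True
  show ?thesis
  proof (rule that[of tl])
    show "\<exists>n. tl Us = take n (tl Us)" for Us :: "'a set list"
      by (metis take_all order_refl)
  qed (use True in \<open>auto simp: cover_strings_def dest: in_set_tl\<close>)
next
  case False
  \<comment> \<open>This is the largest integer below N/\<theta> + 1, that is, the greatest length
    admissible for \<open>N\<close>.\<close>
  define L where "L = nat \<lceil>real N / \<theta>\<rceil>"
  have "real N * \<theta> \<le> real N"
    using assms by (simp add: mult_left_le)
  then have "real N \<le> real N / \<theta>"
    using assms False by (simp add: field_simps)
  moreover have L: "real N / \<theta> \<le> real L" "real L < real N / \<theta> + 1"
    using assms unfolding L_def by (simp_all add: of_nat_nat) linarith+
  ultimately have "N \<le> L" by linarith
  show ?thesis
  proof (rule that[of "\<lambda>Us. take L (tl Us)"])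
    fix Us :: "'a set list" assume "Us \<in> cover_strings \<U> (Suc N) \<theta>"
    then have Us: "Us \<in> lists \<U>" "Suc N \<le> length Us" "real (length Us) < real (Suc N) / \<theta> + 1"
      using False by (auto simp: cover_strings_def)
    \<comment> \<open>If the cut takes effect, the length is \<open>L\<close>, which is admissible.
      Otherwise it is one less than that of \<open>Us\<close>, hence at least \<open>N\<close>, and
      at most \<open>L\<close>.\<close>
    show "take L (tl Us) \<in> cover_strings \<U> N \<theta>"
      using Us L \<open>N \<le> L\<close>
      by (auto simp: cover_strings_def min_def dest!: in_set_takeD in_set_tl)
    \<comment> \<open>Without a cut one letter is lost. With a cut, \<open>Us\<close> is shorter
      than N/\<theta> + 1/\<theta> + 1, which is at most L + 1 + 1/\<theta>.\<close>
    show "real (length Us) \<le> real (length (take L (tl Us))) + (1 + 1 / \<theta>)"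
      using Us L assms by (auto simp: min_def add_divide_distrib of_nat_diff)
  qed auto
qed

lemma entropy_M_le_Suc:
  assumes "f k \<in> topspace X \<rightarrow> topspace X" "W \<subseteq> f k ` Z" "0 \<le> \<theta>" "\<theta> \<le> 1" "0 \<le> \<alpha>"
  shows "entropy_M X f (Suc k) W \<alpha> \<U> N \<theta>
    \<le> ennreal (exp (\<alpha> * (1 + 1 / \<theta>))) * entropy_M X f k Z \<alpha> \<U> (Suc N) \<theta>"
proof (rule entropy_M_cmult_le)
  fix \<G> assume \<G>: "countable \<G>" "\<G> \<subseteq> cover_strings \<U> (Suc N) \<theta>" "Z \<subseteq> (\<Union>Us\<in>\<G>. string_set X f k Us)"
  let ?w = "\<lambda>Us :: 'a set list. ennreal (exp (- \<alpha> * real (length Us)))"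
  let ?c = "ennreal (exp (\<alpha> * (1 + 1 / \<theta>)))"
  obtain g where g: "\<And>Us. \<exists>n. g Us = take n (tl Us)"
    "\<And>Us. Us \<in> cover_strings \<U> (Suc N) \<theta> \<Longrightarrow> g Us \<in> cover_strings \<U> N \<theta>"
    "\<And>Us. Us \<in> cover_strings \<U> (Suc N) \<theta> \<Longrightarrow>
      real (length Us) \<le> real (length (g Us)) + (1 + 1 / \<theta>)"
    using cover_strings_shorten[OF assms(3,4)] by metis
  have "W \<subseteq> (\<Union>Us\<in>g ` \<G>. string_set X f (Suc k) Us)"
  proof
    fix y assume "y \<in> W"
    then obtain x where x: "x \<in> Z" "y = f k x" using assms(2) by blast
    then obtain Us where Us: "Us \<in> \<G>" "x \<in> string_set X f k Us" using \<G>(3) by blast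
    \<comment> \<open>The length is at least \<open>Suc N\<close>, so there is a first letter to
      delete.\<close>
    then have "Us \<noteq> []" using \<G>(2) by (auto simp: cover_strings_def)
    then have "y \<in> string_set X f (Suc k) (tl Us)"
      using Us(2) x(2) string_set_Cons[where f = f, OF assms(1), of x "hd Us" "tl Us"] by simp
    then have "y \<in> string_set X f (Suc k) (g Us)"
      using g(1)[of Us] string_set_take by fastforce
    then show "y \<in> (\<Union>Us\<in>g ` \<G>. string_set X f (Suc k) Us)" using Us(1) by blast
  qed
  moreover have "infsum ?w (g ` \<G>) \<le> ?c * infsum ?w \<G>"
  proof -
    \<comment> \<open>Different strings may become equal after shortening, so only an inequality is
      available.\<close>
    have "infsum ?w (g ` \<G>) \<le> (\<Sum>\<^sub>\<infinity>Us\<in>\<G>. ?w (g Us))"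
      by (rule infsum_image_le_ennreal)
    also have "\<dots> \<le> (\<Sum>\<^sub>\<infinity>Us\<in>\<G>. ?c * ?w Us)"
    proof (intro infsum_mono nonneg_summable_on_complete)
      fix Us assume "Us \<in> \<G>"
      then have "\<alpha> * real (length Us) \<le> \<alpha> * (real (length (g Us)) + (1 + 1 / \<theta>))"
        using \<G>(2) g(3) assms(5) by (intro mult_left_mono) auto
      then show "?w (g Us) \<le> ?c * ?w Us"
        by (simp add: algebra_simps flip: ennreal_mult exp_add)
    qed auto
    finally show ?thesis by (simp add: infsum_cmult_left_ennreal)
  qed
  moreover have "countable (g ` \<G>)" "g ` \<G> \<subseteq> cover_strings \<U> N \<theta>"
    using \<G> g(2) by auto
  ultimately show "\<exists>\<H>. countable \<H> \<and> \<H> \<subseteq> cover_strings \<U> N \<theta> \<and>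
      W \<subseteq> (\<Union>Us\<in>\<H>. string_set X f (Suc k) Us) \<and> infsum ?w \<H> \<le> ?c * infsum ?w \<G>"
    by blast
qed simp

section \<open>One step of the index, and induction on it\<close>

lemma entropy_le_Suc:
  assumes "f k \<in> topspace X \<rightarrow> topspace X" "Z \<subseteq> topspace X" "f k ` Z \<subseteq> W" "0 \<le> \<theta>" "\<theta> \<le> 1"
  shows lower_entropy_le_Suc: "lower_entropy X f k Z \<theta> \<le> lower_entropy X f (Suc k) W \<theta>"
    and upper_entropy_le_Suc: "upper_entropy X f k Z \<theta> \<le> upper_entropy X f (Suc k) W \<theta>"
proof -
  have "\<exists>c. \<forall>N. entropy_M X f k Z \<alpha> \<U> (N + 1) \<theta> \<le> ennreal c * entropy_M X f (Suc k) W \<alpha> \<U> (N + 0) \<theta>"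
    if "finite_open_cover X \<U>" "0 \<le> \<alpha>" for \<U> \<alpha>
  proof (intro exI allI)
    show "entropy_M X f k Z \<alpha> \<U> (N + 1) \<theta>
        \<le> ennreal (1 + card \<U>) * entropy_M X f (Suc k) W \<alpha> \<U> (N + 0) \<theta>" for N
      using entropy_M_Suc_le[where f = f, OF assms, of \<U> \<alpha> N] that
      by (simp add: finite_open_cover_def)
  qed
  from entropy_mono[OF this]
  show "lower_entropy X f k Z \<theta> \<le> lower_entropy X f (Suc k) W \<theta>"
    "upper_entropy X f k Z \<theta> \<le> upper_entropy X f (Suc k) W \<theta>" by blast+
qed

lemma entropy_Suc_le:
  assumes "f k \<in> topspace X \<rightarrow> topspace X" "W \<subseteq> f k ` Z" "0 \<le> \<theta>" "\<theta> \<le> 1"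
  shows lower_entropy_Suc_le: "lower_entropy X f (Suc k) W \<theta> \<le> lower_entropy X f k Z \<theta>"
    and upper_entropy_Suc_le: "upper_entropy X f (Suc k) W \<theta> \<le> upper_entropy X f k Z \<theta>"
proof -
  have "\<exists>c. \<forall>N. entropy_M X f (Suc k) W \<alpha> \<U> (N + 0) \<theta> \<le> ennreal c * entropy_M X f k Z \<alpha> \<U> (N + 1) \<theta>"
    if "0 \<le> \<alpha>" for \<U> \<alpha>
    using entropy_M_le_Suc[where f = f, OF assms that, of \<U>] by auto
  from entropy_mono[OF this]
  show "lower_entropy X f (Suc k) W \<theta> \<le> lower_entropy X f k Z \<theta>"
    "upper_entropy X f (Suc k) W \<theta> \<le> upper_entropy X f k Z \<theta>" by blast+
qed

theorem corollary3p6: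
  fixes X :: "'a topology" and f :: "nat \<Rightarrow> 'a \<Rightarrow> 'a" and Z :: "'a set"
    and i j :: nat and \<theta> :: real
  assumes "compact_space X"
    and "\<And>k. 1 \<le> k \<Longrightarrow> continuous_map X X (f k)"
    and "Z \<subseteq> topspace X"
    and "1 \<le> i" and "i < j"
    and "0 \<le> \<theta>" and "\<theta> \<le> 1"
  shows "((\<forall>k\<ge>1. f k ` Z \<subseteq> Z) \<longrightarrow>
            lower_entropy X f i Z \<theta> \<le> lower_entropy X f j Z \<theta> \<and>
            upper_entropy X f i Z \<theta> \<le> upper_entropy X f j Z \<theta>) \<and>
         ((\<forall>k\<ge>1. Z \<subseteq> f k ` Z) \<longrightarrow>
            lower_entropy X f i Z \<theta> \<ge> lower_entropy X f j Z \<theta> \<and>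
            upper_entropy X f i Z \<theta> \<ge> upper_entropy X f j Z \<theta>) \<and>
         ((\<forall>k\<ge>1. f k ` Z = Z) \<longrightarrow>
            lower_entropy X f i Z \<theta> = lower_entropy X f j Z \<theta> \<and>
            upper_entropy X f i Z \<theta> = upper_entropy X f j Z \<theta>)"
proof -
  have f: "f k \<in> topspace X \<rightarrow> topspace X" if "i \<le> k" for k
    using assms(2)[of k] assms(4) that by (auto simp: continuous_map_def)
  have forward: "lower_entropy X f i Z \<theta> \<le> lower_entropy X f j Z \<theta> \<and>
      upper_entropy X f i Z \<theta> \<le> upper_entropy X f j Z \<theta>" if "\<forall>k\<ge>1. f k ` Z \<subseteq> Z"
    using less_imp_le[OF assms(5)]
  proof (induction j rule: dec_induct)
    case (step k)
    have "f k ` Z \<subseteq> Z" using that step.hyps assms(4) by simp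
    from entropy_le_Suc[where f = f, OF f[OF step.hyps(1)] assms(3) this assms(6,7)] step.IH
    show ?case by (blast intro: order_trans)
  qed simp
  have backward: "lower_entropy X f i Z \<theta> \<ge> lower_entropy X f j Z \<theta> \<and>
      upper_entropy X f i Z \<theta> \<ge> upper_entropy X f j Z \<theta>" if "\<forall>k\<ge>1. Z \<subseteq> f k ` Z"
    using less_imp_le[OF assms(5)]
  proof (induction j rule: dec_induct)
    case (step k)
    have "Z \<subseteq> f k ` Z" using that step.hyps assms(4) by simp
    from entropy_Suc_le[where f = f, OF f[OF step.hyps(1)] this assms(6,7)] step.IH
    show ?case by (blast intro: order_trans)
  qed simp
  \<comment> \<open>Full invariance gives both inclusions, so the third claim follows from the first
    two by antisymmetry.\<close>
  show ?thesis
    using forward backward by (simp add: order_antisym)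
qed

end
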